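(* Let $1<q<p<\infty$ and $\alpha,\beta>0$ with $\frac{\alpha}{p}+\frac{\beta}{q}=1$; set $s=\alpha+\beta$. Let $a<b$, let $\lambda_1(p,q)$ be the first Dirichlet eigenvalue on $(a,b)$ of the system $$-(|u'|^{p-2}u')'=\lambda\alpha|u|^{\alpha-2}u|v|^\beta,\qquad -(|v'|^{q-2}v')'=\lambda\beta|u|^\alpha|v|^{\beta-2}v,$$ with $u(a)=u(b)=v(a)=v(b)=0$, and let $\Lambda_1(s)$ be the first Dirichlet eigenvalue of $-(|\varphi'|^{s-2}\varphi')'=\Lambda|\varphi|^{s-2}\varphi$ on $(a,b)$. Then $$\lambda_1(p,q)\le\Lambda_1(s)\left[\frac1p+\frac1q\left(\frac{\pi_s}{(s-1)\int_0^{\pi_s}\sin_s^s(t)\,dt}\right)^{1-\frac{q}{s}}\right].$$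
   Context: $\lambda_1(p,q)$ is the infimum over $(u,v)\in W^{1,p}_0(a,b)\times W^{1,q}_0(a,b)$ with $\int_a^b|u|^\alpha|v|^\beta>0$ of $\big(\frac1p\int_a^b|u'|^p+\frac1q\int_a^b|v'|^q\big)/\int_a^b|u|^\alpha|v|^\beta$; $\Lambda_1(s)=\inf\{\int_a^b|u'|^s/\int_a^b|u|^s: 0\ne u\in W^{1,s}_0(a,b)\}$. For $s>1$, $\pi_s=2\int_0^1\frac{dt}{(1-t^s)^{1/s}}$, and $\sin_s$ is the solution of $-(|u'|^{s-2}u')'=(s-1)|u|^{s-2}u$, $u(0)=0$, $u'(0)=1$; on $[0,\pi_s/2]$ it is given implicitly by $x=\int_0^{\sin_s(x)}\frac{dt}{(1-t^s)^{1/s}}$, and its first positive zero is $\pi_s$. *)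

theory Defs
  imports "HOL-Analysis.Analysis"
begin

text \<open>One-dimensional Sobolev space W^{1,r}_0(a,b): u is absolutely continuous on [a,b],
  u(a) = u(b) = 0, with derivative g in L^r(a,b).  We record the (a.e. unique)
  derivative g explicitly: sob0 r a b u g means u is in W^{1,r}_0(a,b) with u' = g.\<close>
definition sob0 :: "real \<Rightarrow> real \<Rightarrow> real \<Rightarrow> (real \<Rightarrow> real) \<Rightarrow> (real \<Rightarrow> real) \<Rightarrow> bool" where
  "sob0 r a b u g \<longleftrightarrow>
     g absolutely_integrable_on {a..b} \<and>
     (\<lambda>t. \<bar>g t\<bar> powr r) integrable_on {a..b} \<and>
     (\<forall>x\<in>{a..b}. u x = integral {a..x} g) \<and> u b = 0"

text \<open>First eigenvalue of the (p,q)-system via its Rayleigh quotient.\<close>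
definition lambda1 :: "real \<Rightarrow> real \<Rightarrow> real \<Rightarrow> real \<Rightarrow> real \<Rightarrow> real \<Rightarrow> real" where
  "lambda1 p q \<alpha> \<beta> a b = Inf {R. \<exists>u g v h. sob0 p a b u g \<and> sob0 q a b v h \<and>
      integral {a..b} (\<lambda>t. \<bar>u t\<bar> powr \<alpha> * \<bar>v t\<bar> powr \<beta>) > 0 \<and>
      R = ((1/p) * integral {a..b} (\<lambda>t. \<bar>g t\<bar> powr p)
           + (1/q) * integral {a..b} (\<lambda>t. \<bar>h t\<bar> powr q))
          / integral {a..b} (\<lambda>t. \<bar>u t\<bar> powr \<alpha> * \<bar>v t\<bar> powr \<beta>)}"

text \<open>First eigenvalue of the scalar s-Laplacian via its Rayleigh quotient.\<close>
definition Lambda1 :: "real \<Rightarrow> real \<Rightarrow> real \<Rightarrow> real" where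
  "Lambda1 s a b = Inf {R. \<exists>u g. sob0 s a b u g \<and> (\<exists>x\<in>{a..b}. u x \<noteq> 0) \<and>
      R = integral {a..b} (\<lambda>t. \<bar>g t\<bar> powr s) / integral {a..b} (\<lambda>t. \<bar>u t\<bar> powr s)}"

definition Fs :: "real \<Rightarrow> real \<Rightarrow> real" where
  "Fs s y = integral {0..y} (\<lambda>t. 1 / ((1 - t powr s) powr (1/s)))"

definition pi_s :: "real \<Rightarrow> real" where
  "pi_s s = 2 * Fs s 1"

text \<open>sin_s on [0, pi_s]: inverse of F_s on [0, pi_s/2], and symmetric about pi_s/2
  (the solution of the ODE in the context is symmetric about pi_s/2).\<close>
definition sin_s :: "real \<Rightarrow> real \<Rightarrow> real" where
  "sin_s s x = (if x \<le> pi_s s / 2 then (THE y. 0 \<le> y \<and> y \<le> 1 \<and> Fs s y = x)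
                else (THE y. 0 \<le> y \<and> y \<le> 1 \<and> Fs s y = pi_s s - x))"

end

theory Submission
  imports Defs
begin

text \<open>
  Put \<open>s = \<alpha> + \<beta>\<close>, so that \<open>q < s < p\<close>, and \<open>c = pi_s s / (b - a)\<close>.  The pair \<open>u = v = sin_s (c (x - a)) / c\<close>
  is admissible for the system.  Since \<open>\<bar>u'\<bar> \<le> 1\<close>, the \<open>p\<close>-energy of \<open>u\<close> is at most its \<open>s\<close>-energy,
  and Hoelder's inequality bounds the \<open>q\<close>-energy; with \<open>\<integral> \<bar>cos_s\<bar>\<^sup>s = (s - 1) \<integral> sin_s\<^sup>s\<close> the quotient is at
  most \<open>(s - 1) c\<^sup>s\<close> times the bracket.  What remains is \<open>(s - 1) c\<^sup>s \<le> \<Lambda>\<^sub>1(s)\<close>, the sharp Poincare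
  inequality.  On a half interval of length \<open>pi_s s / 2\<close> it follows from Schur's test: Hoelder's
  inequality with weight \<open>cos_s = sin_s'\<close> gives
  \<open>\<bar>u(x)\<bar>\<^sup>s \<le> sin_s(x)\<^bsup>s-1\<^esup> \<integral>\<^sub>0\<^sup>x \<bar>u'\<bar>\<^sup>s cos_s\<^bsup>1-s\<^esup>\<close>, and Tonelli's theorem together with
  \<open>\<integral> sin_s\<^bsup>s-1\<^esup> = cos_s(t)\<^bsup>s-1\<^esup> / (s - 1)\<close> over \<open>[t, pi_s s / 2]\<close> finishes.  The general case
  follows by rescaling and by reflecting the second half of the interval.
\<close>

section \<open>A weighted Hardy inequality\<close>

text \<open>Young's inequality for \<open>x\<close> and \<open>y powr (s - 1)\<close> with exponents
  \<open>s\<close> and \<open>s / (s - 1)\<close>: the convex power function lies above its tangent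
  at \<open>y\<close>.\<close>

lemma powr_tangent_le:
  fixes s x y :: real
  assumes "1 < s" "0 \<le> x" "0 \<le> y"
  shows "s * y powr (s - 1) * x - (s - 1) * y powr s \<le> x powr s"
proof -
  have "x * y powr (s - 1) \<le> x powr s / s + (y powr (s - 1)) powr (s / (s - 1)) / (s / (s - 1))"
    by (rule Youngs_inequality) (use assms in \<open>auto simp: field_simps\<close>)
  also have "(y powr (s - 1)) powr (s / (s - 1)) = y powr s"
    using assms by (simp add: powr_powr)
  finally show ?thesis using assms by (simp add: field_simps)
qed

text \<open>
  Hoelder's inequality for \<open>\<integral> g\<close> with weight \<open>C\<close>: integrate the tangent line bound for \<open>x powr s\<close>
  at \<open>x = \<bar>g\<bar> / C\<close>, with tangent point \<open>M = (\<integral> \<bar>g\<bar>) / (\<integral> C)\<close>.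
\<close>

lemma integral_powr_le_weighted:
  fixes s x :: real
  assumes s: "1 < s"
    and C: "continuous_on {0..x} C" "\<And>t. t \<in> {0..x} \<Longrightarrow> 0 < C t"
    and S: "(C has_integral S) {0..x}" "0 < S"
    and g: "g absolutely_integrable_on {0..x}"
    and W: "(\<lambda>t. \<bar>g t\<bar> powr s * C t powr (1 - s)) integrable_on {0..x}"
  shows "\<bar>integral {0..x} g\<bar> powr s
          \<le> S powr (s - 1) * integral {0..x} (\<lambda>t. \<bar>g t\<bar> powr s * C t powr (1 - s))"
proof -
  define I where "I = integral {0..x} (\<lambda>t. \<bar>g t\<bar>)"
  have gi: "g integrable_on {0..x}" and ga: "(\<lambda>t. \<bar>g t\<bar>) integrable_on {0..x}"
    using g by (auto simp: absolutely_integrable_on_def)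
  have I0: "0 \<le> I" unfolding I_def by (rule integral_nonneg[OF ga]) auto
  have uI: "\<bar>integral {0..x} g\<bar> \<le> I"
    unfolding I_def using integral_norm_bound_integral[OF gi ga] by simp
  define M where "M = I / S"
  have M0: "0 \<le> M" using I0 S(2) by (simp add: M_def)
  have "((\<lambda>t. s * M powr (s - 1) * \<bar>g t\<bar> - (s - 1) * M powr s * C t)
        has_integral (s * M powr (s - 1) * I - (s - 1) * M powr s * S)) {0..x}"
    unfolding I_def by (intro has_integral_diff has_integral_mult_right integrable_integral ga S(1))
  then have "s * M powr (s - 1) * I - (s - 1) * M powr s * S
      \<le> integral {0..x} (\<lambda>t. \<bar>g t\<bar> powr s * C t powr (1 - s))"
  proof (rule has_integral_le[OF _ integrable_integral[OF W]])
    fix t assume t: "t \<in> {0..x}"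
    have c: "0 < C t" using C(2)[OF t] .
    have "C t * (s * M powr (s - 1) * (\<bar>g t\<bar> / C t) - (s - 1) * M powr s) \<le> C t * (\<bar>g t\<bar> / C t) powr s"
      by (intro mult_left_mono powr_tangent_le) (use s M0 c in auto)
    also have "\<dots> = \<bar>g t\<bar> powr s * C t powr (1 - s)"
      using c by (simp add: powr_divide powr_diff)
    finally show "s * M powr (s - 1) * \<bar>g t\<bar> - (s - 1) * M powr s * C t
        \<le> \<bar>g t\<bar> powr s * C t powr (1 - s)"
      using c by (simp add: algebra_simps)
  qed
  \<comment> \<open>Since \<open>I = M * S\<close>, the integrated tangent bound collapses to
    \<open>M powr s * S\<close>. Multiplied by \<open>S powr (s - 1)\<close> this is
    \<open>I powr s\<close>, so this tangent point recovers Hoelder without loss.\<close>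
  moreover have "s * M powr (s - 1) * I - (s - 1) * M powr s * S = M powr s * S"
  proof -
    have "M powr (s - 1) * I = M powr s * S"
    proof (cases "M = 0")
      case True then show ?thesis using S(2) s by (simp add: M_def)
    next
      case False
      have "I = M * S" using S(2) by (simp add: M_def)
      then show ?thesis using False M0 by (simp add: powr_diff)
    qed
    then show ?thesis by (simp add: algebra_simps)
  qed
  ultimately have "S powr (s - 1) * (M powr s * S)
      \<le> S powr (s - 1) * integral {0..x} (\<lambda>t. \<bar>g t\<bar> powr s * C t powr (1 - s))"
    by (intro mult_left_mono) auto
  moreover have "S powr (s - 1) * (M powr s * S) = I powr s"
    using S(2) I0 by (simp add: M_def powr_divide powr_diff)
  moreover have "\<bar>integral {0..x} g\<bar> powr s \<le> I powr s"
    by (rule powr_mono2) (use s uI in auto)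
  ultimately show ?thesis by linarith
qed

text \<open>Gauge integrability yields Lebesgue measurability only. A change on a null set makes the
  function Borel, which Tonelli's theorem requires later.\<close>

lemma nonneg_integrable_borel_representative:
  fixes f :: "real \<Rightarrow> real"
  assumes "f integrable_on {a..b}" "\<And>t. t \<in> {a..b} \<Longrightarrow> 0 \<le> f t"
  obtains F N where "F \<in> borel_measurable borel" "\<And>t. 0 \<le> F t" "\<And>t. t \<notin> {a..b} \<Longrightarrow> F t = 0"
    "negligible N" "\<And>t. t \<in> {a..b} - N \<Longrightarrow> F t = f t"
proof -
  obtain I where "(f has_integral I) {a..b}" using assms(1) by auto
  then have "(\<lambda>x. indicator {a..b} x *\<^sub>R f x) \<in> borel_measurable lebesgue"
    by (rule has_integral_implies_lebesgue_measurable)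
  then obtain f' where f': "f' \<in> borel_measurable lborel"
      "AE x in lborel. indicator {a..b} x *\<^sub>R f x = f' x"
    using completion_ex_borel_measurable_real by blast
  have "AE x in lebesgue. indicator {a..b} x *\<^sub>R f x = f' x"
    using f'(2) by (rule AE_completion)
  then obtain N where N: "negligible N" "{x. indicator {a..b} x *\<^sub>R f x \<noteq> f' x} \<subseteq> N"
    unfolding eventually_ae_filter_negligible by blast
  \<comment> \<open>The maximum with 0 keeps \<open>F\<close> nonnegative on the exceptional set
    too, where \<open>f'\<close> is arbitrary; the indicator extends by zero.\<close>
  define F where "F = (\<lambda>t. max 0 (f' t) * indicator {a..b} t)"
  show thesis
  proof (rule that[of F N])
    show "F \<in> borel_measurable borel" using f'(1) unfolding F_def by measurable
    show "F t = f t" if "t \<in> {a..b} - N" for t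
    proof -
      have "indicator {a..b} t *\<^sub>R f t = f' t" using that N(2) by blast
      then have "f' t = f t" using that by simp
      then show ?thesis using that assms(2)[of t] by (simp add: F_def)
    qed
  qed (auto simp: F_def N)
qed

text \<open>Schur's test for the integration operator. \<open>SC\<close> and \<open>CS\<close> are
  the integrated form of \<open>S' = C\<close> and
  \<open>(C powr (s - 1))' = - (s - 1) * S powr (s - 1)\<close>, with \<open>S\<close> zero at the
  left end and \<open>C\<close> tending to 0 at \<open>H\<close>. So \<open>S\<close> is an
  eigenfunction for the constant \<open>s - 1\<close>, and \<open>g = C\<close> gives
  equality.\<close>

lemma weighted_hardy_inequality:
  fixes s H :: real and S C g :: "real \<Rightarrow> real"
  assumes s: "1 < s" and H: "0 < H"
    and contS: "continuous_on {0..H} S" and contC: "continuous_on {0..H} C"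
    and Cpos: "\<And>t. \<lbrakk>0 \<le> t; t < H\<rbrakk> \<Longrightarrow> 0 < C t"
    and Spos: "\<And>t. \<lbrakk>0 < t; t < H\<rbrakk> \<Longrightarrow> 0 < S t"
    and SC: "\<And>x. \<lbrakk>0 < x; x < H\<rbrakk> \<Longrightarrow> (C has_integral S x) {0..x}"
    and CS: "\<And>t. \<lbrakk>0 \<le> t; t < H\<rbrakk> \<Longrightarrow>
        ((\<lambda>x. S x powr (s - 1)) has_integral (C t powr (s - 1) / (s - 1))) {t..H}"
    and g: "g absolutely_integrable_on {0..H}"
    and gs: "(\<lambda>t. \<bar>g t\<bar> powr s) integrable_on {0..H}"
  shows "(s - 1) * integral {0..H} (\<lambda>x. \<bar>integral {0..x} g\<bar> powr s)
          \<le> integral {0..H} (\<lambda>t. \<bar>g t\<bar> powr s)"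
proof -
  \<comment> \<open>Tonelli's theorem needs joint Borel measurability, hence the Borel version \<open>F\<close> of \<open>\<bar>g\<bar> powr s\<close>.\<close>
  obtain F N where F: "F \<in> borel_measurable borel" "\<And>t. 0 \<le> F t" "\<And>t. t \<notin> {0..H} \<Longrightarrow> F t = 0"
    and N: "negligible N" "\<And>t. t \<in> {0..H} - N \<Longrightarrow> F t = \<bar>g t\<bar> powr s"
    using nonneg_integrable_borel_representative[OF gs] by auto
  define J where "J = integral {0..H} (\<lambda>t. \<bar>g t\<bar> powr s)"
  have FJ: "(F has_integral J) {0..H}"
    unfolding J_def using N by (intro has_integral_spike[OF _ _ integrable_integral[OF gs]]) auto
  \<comment> \<open>Hypotheses on \<open>S\<close> and \<open>C\<close> concern only
    \<open>{0..H}\<close>. Clamping the argument gives functions continuous on the whole line, hence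
    Borel, which agree with them there.\<close>
  define cl where "cl t = max 0 (min t H)" for t :: real
  have cl_cont: "continuous_on UNIV cl" unfolding cl_def by (intro continuous_intros)
  have cl_mem: "cl t \<in> {0..H}" for t using H by (auto simp: cl_def)
  have cl_id: "cl t = t" if "t \<in> {0..H}" for t using that by (auto simp: cl_def)
  have comp: "continuous_on UNIV (\<lambda>t. f (cl t))" if "continuous_on {0..H} f" for f :: "real \<Rightarrow> real"
    by (rule continuous_on_compose2[OF that cl_cont]) (use cl_mem in auto)
  note [measurable] = F(1) borel_measurable_continuous_onI[OF comp[OF contS]]
    borel_measurable_continuous_onI[OF comp[OF contC]]
  \<comment> \<open>The Borel substitute for
    \<open>\<bar>g t\<bar> powr s * C t powr (1 - s)\<close>, the integrand on the right of the
    weighted Hoelder inequality.\<close>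
  define W where "W t = F t * C (cl t) powr (1 - s)" for t
  have W_meas [measurable]: "W \<in> borel_measurable borel" unfolding W_def by measurable
  have W0: "0 \<le> W t" for t by (simp add: W_def F)
  define u where "u x = integral {0..x} g" for x
  \<comment> \<open>The bound stays strictly below \<open>H\<close>: on \<open>{0..x}\<close> the
    positive continuous \<open>C\<close> has a bounded power \<open>1 - s\<close>, so
    \<open>W\<close> is dominated by a multiple of \<open>F\<close>. Near \<open>H\<close>, where
    \<open>C\<close> tends to 0, this power is unbounded.\<close>
  have bound: "W integrable_on {0..x} \<and> \<bar>u x\<bar> powr s \<le> S x powr (s - 1) * integral {0..x} W"
    if x: "0 < x" "x < H" for x
  proof -
    have sub: "{0..x} \<subseteq> {0..H}" using x by auto
    have Cx: "continuous_on {0..x} C" using contC sub by (rule continuous_on_subset)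
    have Cp: "0 < C t" if "t \<in> {0..x}" for t using Cpos that x by auto
    have "continuous_on {0..x} (\<lambda>t. C t powr (1 - s))"
      by (intro continuous_intros Cx) (use Cp in fastforce)
    then have "bounded ((\<lambda>t. C t powr (1 - s)) ` {0..x})"
      by (intro compact_imp_bounded compact_continuous_image) auto
    then obtain K where K: "\<And>t. t \<in> {0..x} \<Longrightarrow> \<bar>C t powr (1 - s)\<bar> \<le> K"
      unfolding bounded_iff real_norm_def by blast
    have Fx: "F integrable_on {0..x}"
      using integrable_on_subinterval[OF has_integral_integrable[OF FJ] sub] .
    have WI: "W integrable_on {0..x}"
    proof (rule measurable_bounded_by_integrable_imp_integrable)
      show "W \<in> borel_measurable (lebesgue_on {0..x})"
        by (rule measurable_restrict_space1) (use W_meas in \<open>auto intro: measurable_completion\<close>)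
      show "(\<lambda>t. K * F t) integrable_on {0..x}" by (intro integrable_on_mult_right Fx)
      show "norm (W t) \<le> K * F t" if "t \<in> {0..x}" for t
        using that sub mult_left_mono[OF K[OF that] F(2)[of t]] cl_id[of t] F(2)[of t]
        by (auto simp: W_def abs_mult mult.commute)
    qed auto
    let ?w = "\<lambda>t. \<bar>g t\<bar> powr s * C t powr (1 - s)"
    have eq: "?w t = W t" if "t \<in> {0..x} - N" for t
    proof -
      have "t \<in> {0..H} - N" using that sub by auto
      then show ?thesis using N(2)[of t] cl_id[of t] by (simp add: W_def)
    qed
    have wi: "(?w has_integral integral {0..x} W) {0..x}"
      by (rule has_integral_spike[OF N(1) _ integrable_integral[OF WI]]) (use eq in auto)
    have "\<bar>u x\<bar> powr s \<le> S x powr (s - 1) * integral {0..x} ?w"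
      unfolding u_def
    proof (rule integral_powr_le_weighted[OF s Cx Cp SC[OF x] Spos[OF x]])
      show "g absolutely_integrable_on {0..x}"
        using absolutely_integrable_on_subinterval[OF g] sub by simp
    qed (use wi in auto)
    then show ?thesis using WI integral_unique[OF wi] by simp
  qed
  have ucont: "continuous_on {0..H} u"
    unfolding u_def using g by (intro indefinite_integral_continuous_1) (auto simp: absolutely_integrable_on_def)
  have "(\<lambda>x. \<bar>u x\<bar> powr s) integrable_on {0..H}"
    by (intro integrable_continuous_real continuous_on_powr' continuous_intros ucont) (use s in auto)
  then have UI: "((\<lambda>x. \<bar>u x\<bar> powr s) has_integral integral {0..H} (\<lambda>x. \<bar>u x\<bar> powr s)) {0<..<H}"
    using has_integral_Icc_iff_Ioo by blast
  let ?U = "integral {0..H} (\<lambda>x. \<bar>u x\<bar> powr s)"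
  \<comment> \<open>The triangle of pairs with \<open>t\<close> between 0 and \<open>x\<close> is
    put into an indicator, so that the order of integration can be exchanged. Integrating first in
    \<open>t\<close> gives the bound above, first in \<open>x\<close> the identity
    \<open>CS\<close>.\<close>
  let ?k = "\<lambda>x t. ennreal (W t) * (ennreal (S (cl x) powr (s - 1)) * indicator {0<..<H} x * indicator {(x,t). 0 \<le> t \<and> t \<le> x} (x, t))"
  have "ennreal ?U = (\<integral>\<^sup>+x. ennreal (\<bar>u x\<bar> powr s) * indicator {0<..<H} x \<partial>lborel)"
    using nn_integral_has_integral_lebesgue'[OF _ UI] by simp
  also have "\<dots> \<le> (\<integral>\<^sup>+x. (\<integral>\<^sup>+t. ?k x t \<partial>lborel) \<partial>lborel)"
  proof (rule nn_integral_mono)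
    fix x :: real
    show "ennreal (\<bar>u x\<bar> powr s) * indicator {0<..<H} x \<le> (\<integral>\<^sup>+t. ?k x t \<partial>lborel)"
    proof (cases "x \<in> {0<..<H}")
      case False then show ?thesis by simp
    next
      case True
      then have b: "W integrable_on {0..x}" "\<bar>u x\<bar> powr s \<le> S x powr (s - 1) * integral {0..x} W"
        using bound[of x] by auto
      have "(\<integral>\<^sup>+t. ?k x t \<partial>lborel) = (\<integral>\<^sup>+t. ennreal (S x powr (s - 1)) * (ennreal (W t) * indicator {0..x} t) \<partial>lborel)"
        using True by (intro nn_integral_cong) (auto simp: cl_id indicator_def mult.commute)
      also have "\<dots> = ennreal (S x powr (s - 1)) * (\<integral>\<^sup>+t. ennreal (W t) * indicator {0..x} t \<partial>lborel)"
        by (rule nn_integral_cmult) measurable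
      also have "(\<integral>\<^sup>+t. ennreal (W t) * indicator {0..x} t \<partial>lborel) = ennreal (integral {0..x} W)"
        by (rule nn_integral_has_integral_lebesgue'[OF W0 integrable_integral[OF b(1)]])
      finally have "(\<integral>\<^sup>+t. ?k x t \<partial>lborel) = ennreal (S x powr (s - 1) * integral {0..x} W)"
        by (simp add: ennreal_mult')
      then show ?thesis using b(2) True by (simp add: ennreal_leI)
    qed
  qed
  also have "\<dots> = (\<integral>\<^sup>+t. (\<integral>\<^sup>+x. ?k x t \<partial>lborel) \<partial>lborel)"
    by (rule lborel_pair.Fubini'[symmetric]) measurable
  also have "\<dots> \<le> (\<integral>\<^sup>+t. ennreal (F t / (s - 1)) * indicator {0..H} t \<partial>lborel)"
  proof (rule nn_integral_mono)
    fix t :: real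
    show "(\<integral>\<^sup>+x. ?k x t \<partial>lborel) \<le> ennreal (F t / (s - 1)) * indicator {0..H} t"
    proof (cases "0 \<le> t \<and> t < H")
      case False
      then have "(\<integral>\<^sup>+x. ?k x t \<partial>lborel) = (\<integral>\<^sup>+(x::real). 0 \<partial>lborel)"
        by (intro nn_integral_cong) (auto simp: indicator_def)
      then show ?thesis by simp
    next
      case True
      have "(\<integral>\<^sup>+x. ?k x t \<partial>lborel) \<le> (\<integral>\<^sup>+x. ennreal (W t) * (ennreal (S (cl x) powr (s - 1)) * indicator {t..H} x) \<partial>lborel)"
        using True by (intro nn_integral_mono) (auto simp: indicator_def)
      also have "\<dots> = ennreal (W t) * (\<integral>\<^sup>+x. ennreal (S (cl x) powr (s - 1)) * indicator {t..H} x \<partial>lborel)"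
        by (rule nn_integral_cmult) measurable
      also have "(\<integral>\<^sup>+x. ennreal (S (cl x) powr (s - 1)) * indicator {t..H} x \<partial>lborel)
          = (\<integral>\<^sup>+x. ennreal (S x powr (s - 1)) * indicator {t..H} x \<partial>lborel)"
        using True by (intro nn_integral_cong) (auto simp: indicator_def cl_id)
      also have "\<dots> = ennreal (C t powr (s - 1) / (s - 1))"
        by (rule nn_integral_has_integral_lebesgue') (use CS[of t] True in auto)
      \<comment> \<open>The powers \<open>1 - s\<close> and \<open>s - 1\<close> of
        \<open>C t\<close> cancel here. This is why the weight in Hoelder's inequality is
        \<open>C\<close> itself.\<close>
      also have "ennreal (W t) * \<dots> = ennreal (F t / (s - 1))"
      proof -
        have "W t * (C t powr (s - 1) / (s - 1)) = F t / (s - 1)"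
          using True Cpos[of t] by (simp add: W_def cl_id powr_diff)
        then show ?thesis using W0 s by (simp flip: ennreal_mult)
      qed
      finally show ?thesis using True by simp
    qed
  qed
  also have "\<dots> = ennreal (J / (s - 1))"
    by (rule nn_integral_has_integral_lebesgue') (use F s has_integral_divide[OF FJ] in auto)
  finally have "?U \<le> J / (s - 1)"
    using has_integral_nonneg[OF FJ F(2)] s by (simp add: ennreal_le_iff)
  then show ?thesis using s by (simp add: J_def u_def field_simps)
qed

section \<open>Generalized sine and cosine\<close>

text \<open>The factor \<open>e\<close> is the parity about \<open>c\<close>: it is 1 for
  \<open>sin_s\<close> and -1 for \<open>cos_s\<close>. The right half is then the reflected left
  half.\<close>

lemma continuous_on_reflect_union:
  fixes f :: "real \<Rightarrow> real"
  assumes "continuous_on {0..c} f" "\<And>x. f (2 * c - x) = e * f x"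
  shows "continuous_on {0..2 * c} f"
proof (cases "0 \<le> c")
  case True
  have "continuous_on {c..2 * c} (\<lambda>x. e * f (2 * c - x))"
    by (intro continuous_intros continuous_on_compose2[OF assms(1)]) auto
  moreover have "e * f (2 * c - x) = f x" for x
    using assms(2)[of "2 * c - x"] by simp
  ultimately have "continuous_on {c..2 * c} f" by simp
  then have "continuous_on ({0..c} \<union> {c..2 * c}) f"
    by (intro continuous_on_closed_Un assms) auto
  moreover have "{0..c} \<union> {c..2 * c} = {0..2 * c}" using True by auto
  ultimately show ?thesis by simp
qed auto

lemma has_integral_reflect_union:
  fixes f :: "real \<Rightarrow> real"
  assumes "(f has_integral I) {0..c}" "\<And>x. f (2 * c - x) = f x" "0 \<le> c"
  shows "(f has_integral (2 * I)) {0..2 * c}"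
proof -
  have "((\<lambda>x. f (- x + 2 * c)) has_integral I) {c..2 * c}"
    using has_integral_affinity[of f I 0 c "-1" "2 * c"] assms by (simp add: image_affinity_atLeastAtMost)
  moreover have "f (- x + 2 * c) = f x" for x using assms(2)[of x] by (simp add: algebra_simps)
  ultimately have "(f has_integral I) {c..2 * c}" by simp
  from has_integral_combine[OF _ _ assms(1) this] assms(3) show ?thesis by simp
qed

text \<open>The derivative of \<open>sin_s\<close> at interior points off the midpoint, prescribed
  by the first integral \<open>\<bar>cos_s\<bar>^s + sin_s^s = 1\<close>. The sign changes at
  \<open>pi_s s / 2\<close>, where \<open>sin_s\<close> starts to decrease.\<close>

definition cos_s :: "real \<Rightarrow> real \<Rightarrow> real" where
  "cos_s s x = (if x \<le> pi_s s / 2 then (1 - sin_s s x powr s) powr (1 / s)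
                else - ((1 - sin_s s x powr s) powr (1 / s)))"

context
  fixes s :: real
  assumes s: "1 < s"
begin

lemma one_minus_powr_pos:
  assumes "0 \<le> t" "t < 1"
  shows "0 < 1 - t powr s"
  using powr_less_mono2[of s t 1] assms s by simp

section \<open>The integral \<open>Fs\<close>: convergence, derivative and monotonicity\<close>

lemma continuous_on_Fs_integrand:
  assumes "z < 1"
  shows "continuous_on {0..z} (\<lambda>t. 1 / ((1 - t powr s) powr (1 / s)))"
  by (intro continuous_intros continuous_on_powr')
    (use s one_minus_powr_pos assms in force)+

text \<open>On the unit interval \<open>t powr s \<le> t\<close>, so the integrand is at most
  \<open>(1 - t) powr (- (1 / s))\<close>. This has an integrable singularity because
  \<open>1 / s < 1\<close>.\<close>

lemma Fs_integrand_integrable: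
  "(\<lambda>t. 1 / ((1 - t powr s) powr (1 / s))) integrable_on {0..1}"
proof (rule measurable_bounded_by_integrable_imp_integrable)
  show "(\<lambda>t. 1 / ((1 - t powr s) powr (1 / s))) \<in> borel_measurable (lebesgue_on {0..1})"
    by (intro measurable_restrict_space1 measurable_completion) measurable
  define e where "e = 1 - 1 / s"
  have e: "0 < e" "- (1 / s) = e - 1" using s by (simp_all add: e_def)
  have "((\<lambda>t. (1 - t) powr (e - 1)) has_integral
      (- ((1 - 1) powr e / e) - - ((1 - 0) powr e / e))) {0..1::real}"
  proof (rule fundamental_theorem_of_calculus_interior)
    show "continuous_on {0..1} (\<lambda>t. - ((1 - t) powr e / e) :: real)"
      using e by (intro continuous_intros continuous_on_powr') auto
    fix x :: real
    assume "x \<in> {0<..<1}"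
    then have x: "0 < 1 - x" by simp
    have "((\<lambda>t. (1 - t) powr e) has_real_derivative e * (1 - x) powr (e - 1) * (0 - 1)) (at x)"
      by (rule DERIV_chain2[where f = "\<lambda>z. z powr e" and g = "\<lambda>t. 1 - t", OF has_real_derivative_powr[OF x]])
        (intro derivative_intros)
    from DERIV_minus[OF DERIV_cdivide[OF this, of e]]
    show "((\<lambda>t. - ((1 - t) powr e / e)) has_vector_derivative (1 - x) powr (e - 1)) (at x)"
      using e(1) by (simp add: has_real_derivative_iff_has_vector_derivative)
  qed simp
  then show "(\<lambda>t. (1 - t) powr (- (1 / s))) integrable_on {0..1}"
    unfolding e(2) by blast
  show "norm (1 / ((1 - t powr s) powr (1 / s))) \<le> (1 - t) powr (- (1 / s))" if t: "t \<in> {0..1}" for t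
  \<comment> \<open>At \<open>t = 1\<close> both sides are 0, by the conventions for division by
    zero and for powers of zero.\<close>
  proof (cases "t = 1")
    case False
    then have t': "0 \<le> t" "t < 1" using t by auto
    have "t powr s \<le> t powr 1"
      using t' s powr_mono'[of 1 s t] by simp
    then have "(1 - t) powr (1 / s) \<le> (1 - t powr s) powr (1 / s)"
      by (intro powr_mono2) (use t' s in auto)
    moreover have "0 < (1 - t) powr (1 / s)" using t' by simp
    ultimately show ?thesis by (simp add: powr_minus divide_simps)
  qed simp
qed auto

lemma Fs_0: "Fs s 0 = 0" by (simp add: Fs_def)

lemma continuous_on_Fs: "continuous_on {0..1} (Fs s)"
  unfolding Fs_def by (rule indefinite_integral_continuous_1[OF Fs_integrand_integrable])

lemma Fs_has_derivative:
  assumes "0 < y" "y < 1"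
  shows "(Fs s has_real_derivative 1 / ((1 - y powr s) powr (1 / s))) (at y)"
proof -
  \<comment> \<open>The integrand is singular only at 1, so the fundamental theorem is applied on
    \<open>{0..z}\<close>, where it is continuous.\<close>
  obtain z where z: "y < z" "z < 1" using dense[OF assms(2)] by blast
  have "(Fs s has_real_derivative 1 / ((1 - y powr s) powr (1 / s))) (at y within {0..z})"
    unfolding Fs_def
    by (rule integral_has_real_derivative[OF continuous_on_Fs_integrand[OF z(2)]]) (use assms z in auto)
  moreover have "at y within {0..z} = at y"
    by (rule at_within_interior) (use assms z in simp)
  ultimately show ?thesis by simp
qed

lemma Fs_strict_mono:
  assumes "0 \<le> y" "y < z" "z \<le> 1"
  shows "Fs s y < Fs s z"
proof (rule DERIV_pos_imp_increasing_open[OF assms(2)])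
  show "\<exists>d. (Fs s has_real_derivative d) (at x) \<and> 0 < d" if "y < x" "x < z" for x
  proof -
    have x: "0 < x" "x < 1" using that assms by auto
    have "0 < 1 / ((1 - x powr s) powr (1 / s))" using one_minus_powr_pos[of x] x s by simp
    then show ?thesis using Fs_has_derivative[OF x] by blast
  qed
  show "continuous_on {y..z} (Fs s)"
    by (rule continuous_on_subset[OF continuous_on_Fs]) (use assms in auto)
qed

lemma pi_s_pos: "0 < pi_s s"
  using Fs_strict_mono[of 0 1] by (simp add: pi_s_def Fs_0)

lemma Fs_inj:
  assumes "y \<in> {0..1}" "z \<in> {0..1}" "Fs s y = Fs s z"
  shows "y = z"
proof (rule ccontr)
  assume "y \<noteq> z"
  then consider "y < z" | "z < y" by linarith
  then show False
    using Fs_strict_mono[of y z] Fs_strict_mono[of z y] assms by cases simp_all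
qed

lemma Fs_1: "Fs s 1 = pi_s s / 2" by (simp add: pi_s_def)

lemma Fs_bounds: "y \<in> {0..1} \<Longrightarrow> Fs s y \<in> {0..pi_s s / 2}"
proof -
  assume y: "y \<in> {0..1}"
  have "0 \<le> Fs s y"
    using y Fs_strict_mono[of 0 y] Fs_0 by (cases "y = 0") simp_all
  moreover have "Fs s y \<le> pi_s s / 2"
    using y Fs_strict_mono[of y 1] Fs_1 by (cases "y = 1") simp_all
  ultimately show ?thesis by simp
qed

section \<open>\<open>sin_s\<close> on the first half period as the inverse of
  \<open>Fs\<close>\<close>

lemma sin_s_Fs:
  assumes "y \<in> {0..1}"
  shows "sin_s s (Fs s y) = y"
proof -
  have "(THE z. 0 \<le> z \<and> z \<le> 1 \<and> Fs s z = Fs s y) = y"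
    by (rule the_equality) (use assms Fs_inj in auto)
  then show ?thesis using Fs_bounds[OF assms] by (simp add: sin_s_def)
qed

lemma Fs_image: "Fs s ` {0..1} = {0..pi_s s / 2}"
proof
  show "{0..pi_s s / 2} \<subseteq> Fs s ` {0..1}"
  proof
    fix x assume "x \<in> {0..pi_s s / 2}"
    then show "x \<in> Fs s ` {0..1}"
      using IVT'[of "Fs s" 0 x 1, OF _ _ _ continuous_on_Fs] Fs_0 Fs_1 by auto
  qed
qed (use Fs_bounds in auto)

lemma Fs_sin_s:
  assumes "x \<in> {0..pi_s s / 2}"
  shows "Fs s (sin_s s x) = x" "sin_s s x \<in> {0..1}"
proof -
  obtain y where "y \<in> {0..1}" "x = Fs s y" using assms Fs_image by blast
  then show "Fs s (sin_s s x) = x" "sin_s s x \<in> {0..1}" using sin_s_Fs by auto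
qed

lemma sin_s_0: "sin_s s 0 = 0" using sin_s_Fs[of 0] by (simp add: Fs_0)

lemma sin_s_half_pi: "sin_s s (pi_s s / 2) = 1" using sin_s_Fs[of 1] by (simp add: Fs_1)

lemma continuous_on_sin_s_half: "continuous_on {0..pi_s s / 2} (sin_s s)"
proof -
  have "continuous_on (Fs s ` {0..1}) (sin_s s)"
    by (rule continuous_on_inv[OF continuous_on_Fs compact_Icc]) (use sin_s_Fs in blast)
  then show ?thesis unfolding Fs_image .
qed

lemma sin_s_strict_bounds:
  assumes "0 < x" "x < pi_s s / 2"
  shows "0 < sin_s s x" "sin_s s x < 1"
proof -
  have x: "x \<in> {0..pi_s s / 2}" using assms by auto
  have "sin_s s x \<noteq> 0" "sin_s s x \<noteq> 1"
    using Fs_sin_s(1)[OF x] Fs_0 Fs_1 assms by auto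
  then show "0 < sin_s s x" "sin_s s x < 1" using Fs_sin_s(2)[OF x] by auto
qed

lemma sin_s_has_derivative_half:
  assumes "0 < x" "x < pi_s s / 2"
  shows "(sin_s s has_real_derivative cos_s s x) (at x)"
proof -
  note b = sin_s_strict_bounds[OF assms]
  have d: "0 < (1 - sin_s s x powr s) powr (1 / s)" using one_minus_powr_pos[of "sin_s s x"] b s by simp
  have "(sin_s s has_real_derivative inverse (1 / ((1 - sin_s s x powr s) powr (1 / s)))) (at x)"
  proof (rule DERIV_inverse_function[where f = "Fs s" and g = "sin_s s", OF Fs_has_derivative[OF b] _ assms])
    show "1 / (1 - sin_s s x powr s) powr (1 / s) \<noteq> 0" using d by simp
    show "Fs s (sin_s s y) = y" if "0 < y" "y < pi_s s / 2" for y
      using Fs_sin_s(1)[of y] that by simp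
    show "isCont (sin_s s) x"
      by (rule continuous_on_interior[OF continuous_on_sin_s_half]) (use assms in simp)
  qed
  then show ?thesis using assms by (simp add: cos_s_def)
qed

section \<open>Extension to \<open>{0..pi_s s}\<close> by reflection\<close>

lemma sin_s_reflect: "sin_s s (pi_s s - x) = sin_s s x"
\<comment> \<open>Off the midpoint exactly one of the two points falls under the first branch of the
  definition, and the two descriptions become the same. At the midpoint the two points
  coincide.\<close>
proof (cases "x = pi_s s / 2")
  case True
  then have "pi_s s - x = x" by simp
  then show ?thesis by (simp only:)
qed (auto simp: sin_s_def)

lemma cos_s_half_pi: "cos_s s (pi_s s / 2) = 0"
  by (simp add: cos_s_def sin_s_half_pi)

lemma cos_s_reflect: "cos_s s (pi_s s - x) = - cos_s s x"
proof (cases "x = pi_s s / 2")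
  case True
  then have "pi_s s - x = pi_s s / 2" by simp
  then show ?thesis using True cos_s_half_pi by (simp only: minus_zero)
qed (auto simp: cos_s_def sin_s_reflect)

lemma sin_s_bounds: "x \<in> {0..pi_s s} \<Longrightarrow> sin_s s x \<in> {0..1}"
  using Fs_sin_s(2)[of x] Fs_sin_s(2)[of "pi_s s - x"] sin_s_reflect[of x]
  by (cases "x \<le> pi_s s / 2") auto

lemma sin_s_powr_bounds: "x \<in> {0..pi_s s} \<Longrightarrow> sin_s s x powr s \<in> {0..1}"
  using sin_s_bounds[of x] s by (auto intro: powr_le1)

lemma continuous_on_one_minus_sin_s_powr:
  assumes "A \<subseteq> {0..pi_s s}" "continuous_on A (sin_s s)" "0 < r"
  shows "continuous_on A (\<lambda>x. (1 - sin_s s x powr s) powr r)"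
proof (intro continuous_on_powr' continuous_on_diff continuous_on_const assms(2))
  show "\<forall>x\<in>A. 0 \<le> sin_s s x \<and> (sin_s s x = 0 \<longrightarrow> 0 < s)"
    using sin_s_bounds assms(1) s by auto
  show "\<forall>x\<in>A. 0 \<le> 1 - sin_s s x powr s \<and> (1 - sin_s s x powr s = 0 \<longrightarrow> 0 < r)"
    using sin_s_powr_bounds assms by auto
qed

lemma continuous_on_cos_s_half: "continuous_on {0..pi_s s / 2} (cos_s s)"
proof -
  have "continuous_on {0..pi_s s / 2} (\<lambda>x. (1 - sin_s s x powr s) powr (1 / s))"
    by (rule continuous_on_one_minus_sin_s_powr[OF _ continuous_on_sin_s_half]) (use s pi_s_pos in auto)
  then show ?thesis by (rule continuous_on_eq) (simp add: cos_s_def)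
qed

lemma continuous_on_sin_s: "continuous_on {0..pi_s s} (sin_s s)"
  using continuous_on_reflect_union[of "pi_s s / 2" "sin_s s" 1] continuous_on_sin_s_half sin_s_reflect
  by simp

lemma continuous_on_cos_s: "continuous_on {0..pi_s s} (cos_s s)"
  using continuous_on_reflect_union[of "pi_s s / 2" "cos_s s" "-1"] continuous_on_cos_s_half cos_s_reflect
  by simp

lemma continuous_on_sin_s_powr:
  assumes "0 < r"
  shows "continuous_on {0..pi_s s} (\<lambda>x. sin_s s x powr r)"
  by (intro continuous_on_powr' continuous_on_const continuous_on_sin_s) (use assms sin_s_bounds in auto)

lemma continuous_on_abs_cos_s_powr:
  assumes "0 < r"
  shows "continuous_on {0..pi_s s} (\<lambda>x. \<bar>cos_s s x\<bar> powr r)"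
  by (intro continuous_on_powr' continuous_on_const continuous_on_rabs continuous_on_cos_s) (use assms in auto)

lemma sin_s_has_derivative:
  assumes "x \<in> {0<..<pi_s s}" "x \<noteq> pi_s s / 2"
  shows "(sin_s s has_real_derivative cos_s s x) (at x)"
proof (cases "x < pi_s s / 2")
  case True then show ?thesis using sin_s_has_derivative_half assms by simp
next
  case False
  then have "0 < pi_s s - x" "pi_s s - x < pi_s s / 2" using assms by auto
  note D = sin_s_has_derivative_half[OF this]
  have "((\<lambda>x. sin_s s (pi_s s - x)) has_real_derivative cos_s s (pi_s s - x) * (0 - 1)) (at x)"
    by (rule DERIV_chain2[where g = "\<lambda>x. pi_s s - x", OF D]) (intro derivative_intros)
  then show ?thesis by (simp add: sin_s_reflect cos_s_reflect)
qed

lemma cos_s_has_integral: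
  assumes "x \<in> {0..pi_s s}"
  shows "(cos_s s has_integral sin_s s x) {0..x}"
proof -
  have "(cos_s s has_integral (sin_s s x - sin_s s 0)) {0..x}"
  \<comment> \<open>Differentiability is available only off the midpoint, where the two branches
    meet. Continuity there suffices, with the midpoint as an exceptional point.\<close>
  proof (rule fundamental_theorem_of_calculus_interior_strong[of "{pi_s s / 2}"])
    show "continuous_on {0..x} (sin_s s)"
      by (rule continuous_on_subset[OF continuous_on_sin_s]) (use assms in auto)
    show "(sin_s s has_vector_derivative cos_s s t) (at t)" if "t \<in> {0<..<x} - {pi_s s / 2}" for t
      unfolding has_real_derivative_iff_has_vector_derivative[symmetric]
      by (rule sin_s_has_derivative) (use that assms in auto)
  qed (use assms in auto)
  then show ?thesis by (simp add: sin_s_0)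
qed

lemma abs_cos_s_powr: "\<bar>cos_s s x\<bar> powr r = (1 - sin_s s x powr s) powr (r / s)"
  by (simp add: cos_s_def powr_powr)

lemma abs_cos_s_le_1: "x \<in> {0..pi_s s} \<Longrightarrow> \<bar>cos_s s x\<bar> \<le> 1"
  using abs_cos_s_powr[of x 1] sin_s_powr_bounds[of x] s by (auto intro: powr_le1)

lemma cos_s_pos:
  assumes "0 \<le> x" "x < pi_s s / 2"
  shows "0 < cos_s s x"
proof -
  have "0 \<le> sin_s s x" "sin_s s x < 1"
    using sin_s_strict_bounds[of x] sin_s_0 assms by (cases "x = 0"; simp)+
  then show ?thesis using one_minus_powr_pos[of "sin_s s x"] assms by (simp add: cos_s_def)
qed

text \<open>This is the differential equation of \<open>sin_s\<close>: the function is
  \<open>cos_s powr (s - 1)\<close> on the first half period, written through \<open>sin_s\<close>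
  so that the chain rule applies.\<close>

lemma cos_s_powr_has_derivative:
  assumes "0 < x" "x < pi_s s / 2"
  shows "((\<lambda>x. (1 - sin_s s x powr s) powr ((s - 1) / s)) has_real_derivative
           - (s - 1) * sin_s s x powr (s - 1)) (at x)"
proof -
  note b = sin_s_strict_bounds[OF assms]
  let ?z = "1 - sin_s s x powr s"
  have z: "0 < ?z" using one_minus_powr_pos b by simp
  have D: "((\<lambda>x. 1 - sin_s s x powr s) has_real_derivative
      0 - s * sin_s s x powr (s - 1) * cos_s s x) (at x)"
    by (intro derivative_intros DERIV_chain2[OF has_real_derivative_powr]
       sin_s_has_derivative_half assms b)
  have "((\<lambda>x. (1 - sin_s s x powr s) powr ((s - 1) / s)) has_real_derivative
      (s - 1) / s * ?z powr ((s - 1) / s - 1) * (0 - s * sin_s s x powr (s - 1) * cos_s s x)) (at x)"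
    by (rule DERIV_chain2[where f = "\<lambda>z. z powr ((s - 1) / s)" and g = "\<lambda>x. 1 - sin_s s x powr s",
          OF has_real_derivative_powr[OF z] D])
  \<comment> \<open>The outer derivative contributes the exponent
    \<open>(s - 1) / s - 1 = - 1 / s\<close>, which cancels against \<open>cos_s\<close>.\<close>
  moreover have "?z powr ((s - 1) / s - 1) * cos_s s x = 1"
  proof -
    have "?z powr ((s - 1) / s - 1) * cos_s s x = ?z powr ((s - 1) / s - 1 + 1 / s)"
      using assms by (simp add: cos_s_def powr_add)
    also have "(s - 1) / s - 1 + 1 / s = 0" using s by (simp add: field_simps)
    finally show ?thesis using z by simp
  qed
  moreover have "(s - 1) / s * A * (0 - s * B * C) = - (s - 1) * B * (A * C)" for A B C :: real
    using s by (simp add: field_simps)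
  ultimately have "((\<lambda>x. (1 - sin_s s x powr s) powr ((s - 1) / s)) has_real_derivative
      - (s - 1) * sin_s s x powr (s - 1) * 1) (at x)"
    by metis
  then show ?thesis by simp
qed

lemma cos_s_powr_eq:
  "0 \<le> x \<Longrightarrow> x \<le> pi_s s / 2 \<Longrightarrow> (1 - sin_s s x powr s) powr ((s - 1) / s) = cos_s s x powr (s - 1)"
  by (simp add: cos_s_def powr_powr)

lemma continuous_on_cos_s_powr:
  "continuous_on {0..pi_s s / 2} (\<lambda>x. (1 - sin_s s x powr s) powr ((s - 1) / s))"
  by (rule continuous_on_one_minus_sin_s_powr[OF _ continuous_on_sin_s_half]) (use s pi_s_pos in auto)

text \<open>Integrates the differential equation from \<open>t\<close> to \<open>pi_s s / 2\<close>,
  where the boundary term vanishes because \<open>cos_s\<close> does. It supplies \<open>CS\<close>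
  for the Hardy inequality.\<close>

lemma sin_s_powr_has_integral:
  assumes "0 \<le> t" "t \<le> pi_s s / 2"
  shows "((\<lambda>x. sin_s s x powr (s - 1)) has_integral (cos_s s t powr (s - 1) / (s - 1))) {t..pi_s s / 2}"
proof -
  let ?f = "\<lambda>x. (1 - sin_s s x powr s) powr ((s - 1) / s)"
  have "((\<lambda>x. - (s - 1) * sin_s s x powr (s - 1)) has_integral (?f (pi_s s / 2) - ?f t)) {t..pi_s s / 2}"
  proof (rule fundamental_theorem_of_calculus_interior)
    show "continuous_on {t..pi_s s / 2} ?f"
      by (rule continuous_on_subset[OF continuous_on_cos_s_powr]) (use assms in auto)
    show "(?f has_vector_derivative - (s - 1) * sin_s s x powr (s - 1)) (at x)"
      if "x \<in> {t<..<pi_s s / 2}" for x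
      unfolding has_real_derivative_iff_has_vector_derivative[symmetric]
      by (rule cos_s_powr_has_derivative) (use that assms in auto)
  qed (use assms in auto)
  from has_integral_mult_right[OF this, of "- 1 / (s - 1)"]
  have "((\<lambda>x. - 1 / (s - 1) * (- (s - 1) * sin_s s x powr (s - 1))) has_integral
      cos_s s t powr (s - 1) / (s - 1)) {t..pi_s s / 2}"
    using assms by (simp add: sin_s_half_pi cos_s_powr_eq)
  moreover have "- 1 / (s - 1) * (- (s - 1) * sin_s s x powr (s - 1)) = sin_s s x powr (s - 1)" for x
    using s by (simp add: divide_simps) (simp add: algebra_simps)
  ultimately show ?thesis by simp
qed

text \<open>Testing the differential equation with \<open>sin_s\<close>: the derivative of
  \<open>sin_s * cos_s powr (s - 1)\<close> is the difference of the two integrands. The product is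
  zero at 0 and at \<open>pi_s s / 2\<close>, and reflection carries the identity to the full
  interval.\<close>

lemma cos_s_powr_integral:
  "integral {0..pi_s s} (\<lambda>x. \<bar>cos_s s x\<bar> powr s)
    = (s - 1) * integral {0..pi_s s} (\<lambda>x. sin_s s x powr s)"
proof -
  let ?f = "\<lambda>x. sin_s s x * (1 - sin_s s x powr s) powr ((s - 1) / s)"
  let ?d = "\<lambda>x. \<bar>cos_s s x\<bar> powr s - (s - 1) * sin_s s x powr s"
  have "(?d has_integral (?f (pi_s s / 2) - ?f 0)) {0..pi_s s / 2}"
  proof (rule fundamental_theorem_of_calculus_interior)
    show "continuous_on {0..pi_s s / 2} ?f"
      by (rule continuous_on_mult[OF continuous_on_sin_s_half continuous_on_cos_s_powr])
    fix x assume "x \<in> {0<..<pi_s s / 2}"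
    then have x: "0 < x" "x < pi_s s / 2" by auto
    have "(?f has_real_derivative sin_s s x * (- (s - 1) * sin_s s x powr (s - 1))
        + cos_s s x * (1 - sin_s s x powr s) powr ((s - 1) / s)) (at x)"
      by (rule DERIV_mult'[OF sin_s_has_derivative_half[OF x] cos_s_powr_has_derivative[OF x]])
    also have "sin_s s x * (- (s - 1) * sin_s s x powr (s - 1))
        + cos_s s x * (1 - sin_s s x powr s) powr ((s - 1) / s) = ?d x"
      using x cos_s_pos[of x] sin_s_strict_bounds[OF x] by (simp add: cos_s_powr_eq powr_diff) (simp add: algebra_simps)
    finally show "(?f has_vector_derivative ?d x) (at x)"
      by (simp add: has_real_derivative_iff_has_vector_derivative)
  qed (use pi_s_pos in auto)
  then have "(?d has_integral 0) {0..pi_s s / 2}" by (simp add: sin_s_0 sin_s_half_pi)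
  from has_integral_reflect_union[OF this] have "(?d has_integral 0) {0..pi_s s}"
    using pi_s_pos by (simp add: sin_s_reflect cos_s_reflect)
  moreover have "(?d has_integral (integral {0..pi_s s} (\<lambda>x. \<bar>cos_s s x\<bar> powr s)
      - (s - 1) * integral {0..pi_s s} (\<lambda>x. sin_s s x powr s))) {0..pi_s s}"
    by (intro has_integral_diff has_integral_mult_right integrable_integral integrable_continuous_real
      continuous_on_sin_s_powr continuous_on_abs_cos_s_powr) (use s in auto)
  ultimately have "0 = integral {0..pi_s s} (\<lambda>x. \<bar>cos_s s x\<bar> powr s)
      - (s - 1) * integral {0..pi_s s} (\<lambda>x. sin_s s x powr s)"
    by (rule has_integral_unique)
  then show ?thesis by simp
qed

lemma sin_s_powr_integral_pos: "0 < integral {0..pi_s s} (\<lambda>x. sin_s s x powr s)"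
proof -
  have "integral {0..pi_s s} (\<lambda>x. 0) < integral {0..pi_s s} (\<lambda>x. sin_s s x powr s)"
  proof (rule integral_less_real)
    show "continuous_on {0..pi_s s} (\<lambda>x. sin_s s x powr s)"
      by (rule continuous_on_sin_s_powr) (use s in simp)
    show "0 < sin_s s x powr s" if "x \<in> {0<..<pi_s s}" for x
    proof -
      have "0 < sin_s s x"
      proof (cases "x = pi_s s / 2")
        case True
        show ?thesis unfolding True sin_s_half_pi by simp
      next
        case False
        then show ?thesis
          using sin_s_strict_bounds(1)[of x] sin_s_strict_bounds(1)[of "pi_s s - x"] that sin_s_reflect[of x]
          by (cases "x < pi_s s / 2") auto
      qed
      then show ?thesis by simp
    qed
  qed (use pi_s_pos in auto)
  then show ?thesis by simp
qed

end

section \<open>The sharp Poincare inequality\<close>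

lemma has_integral_affine_pos:
  fixes f :: "real \<Rightarrow> real"
  assumes "(f has_integral I) {a..a + k * c}" "0 < k"
  shows "((\<lambda>t. f (a + k * t)) has_integral I / k) {0..c}"
proof -
  have image: "(a - a) /\<^sub>R k = 0" "(a + k * c - a) /\<^sub>R k = c" using assms(2) by simp_all
  show ?thesis
    using has_integral_affinity'[of f I a "a + k * c" k a, unfolded image box_real] assms
    by (simp add: add.commute divide_inverse_commute)
qed

lemma has_integral_reflect_at:
  fixes f :: "real \<Rightarrow> real"
  assumes "(f has_integral I) {b - c..b}"
  shows "((\<lambda>t. f (b - t)) has_integral I) {0..c}"
  using has_integral_affinity[of f I "b - c" b "-1" b] assms
  by (cases "0 \<le> c") (simp_all add: image_affinity_atLeastAtMost)

lemma absolutely_integrable_affine_pos: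
  fixes f :: "real \<Rightarrow> real"
  assumes "f absolutely_integrable_on {a..a + k * c}" "0 < k"
  shows "(\<lambda>t. f (a + k * t)) absolutely_integrable_on {0..c}"
proof -
  obtain I J where "(f has_integral I) {a..a + k * c}" "((\<lambda>t. \<bar>f t\<bar>) has_integral J) {a..a + k * c}"
    using assms(1) unfolding absolutely_integrable_on_def integrable_on_def real_norm_def by blast
  note this[THEN has_integral_affine_pos[OF _ assms(2)]]
  then show ?thesis unfolding absolutely_integrable_on_def integrable_on_def real_norm_def by blast
qed

lemma absolutely_integrable_reflect_at:
  fixes f :: "real \<Rightarrow> real"
  assumes "f absolutely_integrable_on {b - c..b}"
  shows "(\<lambda>t. f (b - t)) absolutely_integrable_on {0..c}"
proof -
  obtain I J where "(f has_integral I) {b - c..b}" "((\<lambda>t. \<bar>f t\<bar>) has_integral J) {b - c..b}"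
    using assms unfolding absolutely_integrable_on_def integrable_on_def real_norm_def by blast
  note this[THEN has_integral_reflect_at]
  then show ?thesis unfolding absolutely_integrable_on_def integrable_on_def real_norm_def by blast
qed

text \<open>The Hardy inequality with \<open>S = sin_s\<close> and \<open>C = cos_s\<close>,
  rescaled from length \<open>pi_s s / 2\<close> to length \<open>L\<close>. The function vanishes
  at 0 and is free at \<open>L\<close>, just as \<open>sin_s\<close> on its first half
  period.\<close>

lemma poincare_half_interval:
  fixes s L :: real
  assumes s: "1 < s" and L: "0 < L"
    and g: "g absolutely_integrable_on {0..L}" and gs: "(\<lambda>t. \<bar>g t\<bar> powr s) integrable_on {0..L}"
  shows "(s - 1) * (pi_s s / 2 / L) powr s * integral {0..L} (\<lambda>x. \<bar>integral {0..x} g\<bar> powr s)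
          \<le> integral {0..L} (\<lambda>t. \<bar>g t\<bar> powr s)"
proof -
  define H where "H = pi_s s / 2"
  have H: "0 < H" using pi_s_pos[OF s] by (simp add: H_def)
  \<comment> \<open>The substitution \<open>x = k * y\<close> replaces \<open>g\<close> by
    \<open>k * g (k * y)\<close>. The energy gains \<open>k powr s\<close>, while the Jacobian
    \<open>1 / k\<close> occurs on both sides and cancels.\<close>
  define k where "k = L / H"
  have k: "0 < k" "k * H = L" using H L by (simp_all add: k_def)
  define u where "u x = integral {0..x} g" for x
  have gi: "g integrable_on {0..L}" using g by (auto simp: absolutely_integrable_on_def)
  have u_scale: "integral {0..y} (\<lambda>t. k * g (k * t)) = u (k * y)" if "y \<in> {0..H}" for y
  proof -
    have "k * y \<le> L" using that k mult_left_mono[of y H k] by simp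
    then have "g integrable_on {0..k * y}"
      using integrable_on_subinterval[OF gi] by simp
    from has_integral_affine_pos[of g _ 0 k y] integrable_integral[OF this]
    have "((\<lambda>t. g (k * t)) has_integral u (k * y) / k) {0..y}" using k by (simp add: u_def)
    from has_integral_mult_right[OF this, of k]
    have "((\<lambda>t. k * g (k * t)) has_integral u (k * y)) {0..y}" using k by simp
    then show ?thesis by (rule integral_unique)
  qed
  have ucont: "continuous_on {0..L} u" unfolding u_def by (rule indefinite_integral_continuous_1[OF gi])
  have ui: "(\<lambda>x. \<bar>u x\<bar> powr s) integrable_on {0..L}"
    by (intro integrable_continuous_real continuous_on_powr' continuous_on_const continuous_on_rabs ucont)
      (use s in auto)
  have "((\<lambda>y. \<bar>u (k * y)\<bar> powr s) has_integral integral {0..L} (\<lambda>x. \<bar>u x\<bar> powr s) / k) {0..H}"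
    using has_integral_affine_pos[of "\<lambda>x. \<bar>u x\<bar> powr s" _ 0 k H] integrable_integral[OF ui] k by simp
  then have "((\<lambda>y. \<bar>integral {0..y} (\<lambda>t. k * g (k * t))\<bar> powr s) has_integral
      integral {0..L} (\<lambda>x. \<bar>u x\<bar> powr s) / k) {0..H}"
    by (rule has_integral_eq[rotated]) (simp only: u_scale)
  note 1 = integral_unique[OF this]
  have "((\<lambda>t. \<bar>g (k * t)\<bar> powr s) has_integral integral {0..L} (\<lambda>x. \<bar>g x\<bar> powr s) / k) {0..H}"
    using has_integral_affine_pos[of "\<lambda>x. \<bar>g x\<bar> powr s" _ 0 k H] integrable_integral[OF gs] k by simp
  from has_integral_mult_right[OF this, of "k powr s"]
  have 2: "((\<lambda>t. \<bar>k * g (k * t)\<bar> powr s) has_integral k powr s * (integral {0..L} (\<lambda>x. \<bar>g x\<bar> powr s) / k)) {0..H}"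
    using k by (simp add: abs_mult powr_mult)
  have "(s - 1) * integral {0..H} (\<lambda>y. \<bar>integral {0..y} (\<lambda>t. k * g (k * t))\<bar> powr s)
      \<le> integral {0..H} (\<lambda>t. \<bar>k * g (k * t)\<bar> powr s)"
  proof (rule weighted_hardy_inequality[OF s H])
    show "continuous_on {0..H} (sin_s s)" "continuous_on {0..H} (cos_s s)"
      unfolding H_def by (rule continuous_on_sin_s_half[OF s] continuous_on_cos_s_half[OF s])+
    show "0 < cos_s s t" if "0 \<le> t" "t < H" for t using cos_s_pos[OF s] that by (simp add: H_def)
    show "0 < sin_s s t" if "0 < t" "t < H" for t using sin_s_strict_bounds(1)[OF s] that by (simp add: H_def)
    show "(cos_s s has_integral sin_s s x) {0..x}" if "0 < x" "x < H" for x
      by (rule cos_s_has_integral[OF s]) (use that H in \<open>auto simp: H_def\<close>)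
    show "((\<lambda>x. sin_s s x powr (s - 1)) has_integral cos_s s t powr (s - 1) / (s - 1)) {t..H}"
      if "0 \<le> t" "t < H" for t
      using sin_s_powr_has_integral[OF s, of t] that by (simp add: H_def)
    show "(\<lambda>t. k * g (k * t)) absolutely_integrable_on {0..H}"
      using absolutely_integrable_affine_pos[where f = g and a = 0 and k = k and c = H] g k by (simp add: absolutely_integrable_scaleR_left)
    show "(\<lambda>t. \<bar>k * g (k * t)\<bar> powr s) integrable_on {0..H}" using 2 by blast
  qed
  then have "(s - 1) * (integral {0..L} (\<lambda>x. \<bar>u x\<bar> powr s) / k)
      \<le> k powr s * (integral {0..L} (\<lambda>x. \<bar>g x\<bar> powr s) / k)"
    unfolding 1 integral_unique[OF 2] .
  then have "(s - 1) * integral {0..L} (\<lambda>x. \<bar>u x\<bar> powr s)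
      \<le> k powr s * integral {0..L} (\<lambda>x. \<bar>g x\<bar> powr s)"
    using k(1) by (simp add: divide_le_cancel)
  then have "(s - 1) * integral {0..L} (\<lambda>x. \<bar>u x\<bar> powr s) / k powr s \<le> integral {0..L} (\<lambda>x. \<bar>g x\<bar> powr s)"
    using k(1) by (simp add: pos_divide_le_eq mult.commute)
  moreover have "(pi_s s / 2 / L) powr s = 1 / k powr s"
    using H L by (simp add: k_def powr_divide flip: H_def)
  ultimately show ?thesis by (simp add: u_def)
qed

section \<open>The Poincare inequality on the full interval and the lower bound for
  \<open>Lambda1\<close>\<close>

lemma sob0_continuous_on:
  assumes "sob0 r a b u g"
  shows "continuous_on {a..b} u"
proof (rule continuous_on_eq)
  show "continuous_on {a..b} (\<lambda>x. integral {a..x} g)"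
    by (rule indefinite_integral_continuous_1)
      (use assms in \<open>auto simp: sob0_def absolutely_integrable_on_def\<close>)
qed (use assms in \<open>auto simp: sob0_def\<close>)

text \<open>The interval is cut at its midpoint. Each half carries one Dirichlet endpoint, from
  which \<open>u\<close> is recovered by integration, and the half-interval inequality leaves the
  value at the midpoint free. Both halves have the same constant, so the estimates add up.\<close>

lemma sharp_poincare:
  fixes s a b :: real
  assumes s: "1 < s" and ab: "a < b" and sob: "sob0 s a b u g"
  shows "(s - 1) * (pi_s s / (b - a)) powr s * integral {a..b} (\<lambda>t. \<bar>u t\<bar> powr s)
          \<le> integral {a..b} (\<lambda>t. \<bar>g t\<bar> powr s)"
proof -
  define L where "L = (b - a) / 2"
  have L: "0 < L" "a + L = b - L" using ab by (simp_all add: L_def field_simps)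
  have g: "g absolutely_integrable_on {a..b}" and gs: "(\<lambda>t. \<bar>g t\<bar> powr s) integrable_on {a..b}"
    and u: "\<And>x. x \<in> {a..b} \<Longrightarrow> u x = integral {a..x} g" and ub: "u b = 0"
    using sob by (auto simp: sob0_def)
  have gi: "g integrable_on {a..b}" using g by (auto simp: absolutely_integrable_on_def)
  have sub: "{a..a + L} \<subseteq> {a..b}" "{b - L..b} \<subseteq> {a..b}" using L ab by auto
  have ucont: "continuous_on {a..b} u" by (rule sob0_continuous_on[OF sob])
  have us: "(\<lambda>t. \<bar>u t\<bar> powr s) integrable_on {a..b}"
    by (intro integrable_continuous_real continuous_on_powr' continuous_on_const continuous_on_rabs ucont)
      (use s in auto)
  let ?k = "(s - 1) * (pi_s s / 2 / L) powr s"
  have shift: "((\<lambda>t. f (a + t)) has_integral integral {a..a + L} f) {0..L}"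
    if "f integrable_on {a..b}" for f :: "real \<Rightarrow> real"
    using has_integral_affine_pos[of f _ a 1 L] integrable_integral[OF integrable_on_subinterval[OF that sub(1)]]
    by simp
  have reflect: "((\<lambda>t. f (b - t)) has_integral integral {b - L..b} f) {0..L}"
    if "f integrable_on {a..b}" for f :: "real \<Rightarrow> real"
    by (rule has_integral_reflect_at[OF integrable_integral[OF integrable_on_subinterval[OF that sub(2)]]])
  have lower_left: "?k * integral {0..L} (\<lambda>x. \<bar>integral {0..x} (\<lambda>t. g (a + t))\<bar> powr s)
      \<le> integral {0..L} (\<lambda>t. \<bar>g (a + t)\<bar> powr s)"
  proof (rule poincare_half_interval[OF s L(1)])
    show "(\<lambda>t. g (a + t)) absolutely_integrable_on {0..L}"
      using absolutely_integrable_affine_pos[where f = g and a = a and k = 1 and c = L] absolutely_integrable_on_subinterval[OF g sub(1)] by simp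
    show "(\<lambda>t. \<bar>g (a + t)\<bar> powr s) integrable_on {0..L}" using shift[OF gs] by blast
  qed
  have u_left: "integral {0..x} (\<lambda>t. g (a + t)) = u (a + x)" if "x \<in> {0..L}" for x
  proof -
    have "{a..a + x} \<subseteq> {a..b}" using that L ab by (auto simp: L_def)
    then have "((\<lambda>t. g (a + t)) has_integral integral {a..a + x} g) {0..x}"
      using has_integral_affine_pos[of g _ a 1 x] integrable_integral[OF integrable_on_subinterval[OF gi]] by simp
    then show ?thesis using u[of "a + x"] that L ab by (simp add: integral_unique L_def)
  qed
  have "integral {0..L} (\<lambda>x. \<bar>integral {0..x} (\<lambda>t. g (a + t))\<bar> powr s)
      = integral {0..L} (\<lambda>x. \<bar>u (a + x)\<bar> powr s)"
    by (rule integral_cong) (simp only: u_left)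
  then have left: "?k * integral {a..a + L} (\<lambda>t. \<bar>u t\<bar> powr s) \<le> integral {a..a + L} (\<lambda>t. \<bar>g t\<bar> powr s)"
    using lower_left integral_unique[OF shift[OF us]] integral_unique[OF shift[OF gs]] by (simp only:)
  have lower_right: "?k * integral {0..L} (\<lambda>x. \<bar>integral {0..x} (\<lambda>t. g (b - t))\<bar> powr s)
      \<le> integral {0..L} (\<lambda>t. \<bar>g (b - t)\<bar> powr s)"
  proof (rule poincare_half_interval[OF s L(1)])
    show "(\<lambda>t. g (b - t)) absolutely_integrable_on {0..L}"
      by (rule absolutely_integrable_reflect_at[OF absolutely_integrable_on_subinterval[OF g sub(2)]])
    show "(\<lambda>t. \<bar>g (b - t)\<bar> powr s) integrable_on {0..L}" using reflect[OF gs] by blast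
  qed
  \<comment> \<open>Integrating backwards from \<open>b\<close> and using \<open>u b = 0\<close>
    gives \<open>- u (b - x)\<close>; the sign disappears under the absolute value.\<close>
  have u_right: "integral {0..x} (\<lambda>t. g (b - t)) = - u (b - x)" if "x \<in> {0..L}" for x
  proof -
    have x: "a \<le> b - x" "b - x \<le> b" using that L ab by (auto simp: L_def)
    then have "{b - x..b} \<subseteq> {a..b}" by auto
    then have "integral {0..x} (\<lambda>t. g (b - t)) = integral {b - x..b} g"
      using has_integral_reflect_at[OF integrable_integral[OF integrable_on_subinterval[OF gi]]] integral_unique
      by blast
    also have "\<dots> = - u (b - x)"
      using Henstock_Kurzweil_Integration.integral_combine[OF x gi] u[of b] u[of "b - x"] ub x ab by simp
    finally show ?thesis .
  qed
  have "integral {0..L} (\<lambda>x. \<bar>integral {0..x} (\<lambda>t. g (b - t))\<bar> powr s)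
      = integral {0..L} (\<lambda>x. \<bar>u (b - x)\<bar> powr s)"
    by (rule integral_cong) (simp only: u_right abs_minus_cancel)
  then have right: "?k * integral {b - L..b} (\<lambda>t. \<bar>u t\<bar> powr s) \<le> integral {b - L..b} (\<lambda>t. \<bar>g t\<bar> powr s)"
    using lower_right integral_unique[OF reflect[OF us]] integral_unique[OF reflect[OF gs]] by (simp only:)
  have split: "integral {a..b} f = integral {a..a + L} f + integral {b - L..b} f"
    if "f integrable_on {a..b}" for f :: "real \<Rightarrow> real"
  proof -
    have "a \<le> a + L" "a + L \<le> b" using L by auto
    from Henstock_Kurzweil_Integration.integral_combine[OF this that] show ?thesis by (simp add: L(2))
  qed
  have scale: "pi_s s / 2 / L = pi_s s / (b - a)" by (simp add: L_def)
  show ?thesis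
    using left right unfolding scale split[OF us] split[OF gs] distrib_left by linarith
qed

text \<open>Every admissible quotient obeys the Poincare bound. The pair \<open>u0\<close>,
  \<open>g0\<close> only witnesses that the set of quotients is nonempty, so that its infimum is
  meaningful.\<close>

lemma Lambda1_ge:
  assumes s: "1 < s" and ab: "a < b" and ne: "sob0 s a b u0 g0" "\<exists>x\<in>{a..b}. u0 x \<noteq> 0"
  shows "(s - 1) * (pi_s s / (b - a)) powr s \<le> Lambda1 s a b"
  unfolding Lambda1_def
proof (rule cInf_greatest)
  fix R
  assume "R \<in> {R. \<exists>u g. sob0 s a b u g \<and> (\<exists>x\<in>{a..b}. u x \<noteq> 0) \<and>
      R = integral {a..b} (\<lambda>t. \<bar>g t\<bar> powr s) / integral {a..b} (\<lambda>t. \<bar>u t\<bar> powr s)}"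
  then obtain u g x where sob: "sob0 s a b u g" and x: "x \<in> {a..b}" "u x \<noteq> 0"
    and R: "R = integral {a..b} (\<lambda>t. \<bar>g t\<bar> powr s) / integral {a..b} (\<lambda>t. \<bar>u t\<bar> powr s)"
    by blast
  have ucont: "continuous_on {a..b} u" by (rule sob0_continuous_on[OF sob])
  have uscont: "continuous_on {a..b} (\<lambda>t. \<bar>u t\<bar> powr s)"
    by (intro continuous_on_powr' continuous_on_const continuous_on_rabs ucont) (use s in auto)
  have "integral {a..b} (\<lambda>t. \<bar>u t\<bar> powr s) \<noteq> 0"
    using integral_eq_0_iff[OF uscont ab] x by auto
  moreover have "0 \<le> integral {a..b} (\<lambda>t. \<bar>u t\<bar> powr s)"
    by (intro integral_nonneg integrable_continuous_real uscont) auto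
  ultimately have "0 < integral {a..b} (\<lambda>t. \<bar>u t\<bar> powr s)" by linarith
  then show "(s - 1) * (pi_s s / (b - a)) powr s \<le> R"
    using sharp_poincare[OF s ab sob] by (simp add: R pos_le_divide_eq)
qed (use ne in blast)

section \<open>The upper bound\<close>

text \<open>For real infima, membership gives an upper bound only if the set is bounded below; here
  all quotients are nonnegative.\<close>

lemma lambda1_le:
  assumes "0 < p" "0 < q" "sob0 p a b u g" "sob0 q a b v h"
    and "0 < integral {a..b} (\<lambda>t. \<bar>u t\<bar> powr \<alpha> * \<bar>v t\<bar> powr \<beta>)"
  shows "lambda1 p q \<alpha> \<beta> a b \<le>
      ((1/p) * integral {a..b} (\<lambda>t. \<bar>g t\<bar> powr p) + (1/q) * integral {a..b} (\<lambda>t. \<bar>h t\<bar> powr q))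
      / integral {a..b} (\<lambda>t. \<bar>u t\<bar> powr \<alpha> * \<bar>v t\<bar> powr \<beta>)"
  unfolding lambda1_def
proof (rule cInf_lower)
  have nonneg: "0 \<le> integral {a..b} (\<lambda>t. \<bar>g t\<bar> powr r)" if "sob0 r a b u g" for r u and g :: "real \<Rightarrow> real"
    using that by (intro integral_nonneg) (auto simp: sob0_def)
  show "bdd_below {R. \<exists>u g v h. sob0 p a b u g \<and> sob0 q a b v h \<and>
      integral {a..b} (\<lambda>t. \<bar>u t\<bar> powr \<alpha> * \<bar>v t\<bar> powr \<beta>) > 0 \<and>
      R = ((1/p) * integral {a..b} (\<lambda>t. \<bar>g t\<bar> powr p)
           + (1/q) * integral {a..b} (\<lambda>t. \<bar>h t\<bar> powr q))
          / integral {a..b} (\<lambda>t. \<bar>u t\<bar> powr \<alpha> * \<bar>v t\<bar> powr \<beta>)}"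
  proof (rule bdd_belowI[of _ 0], elim CollectE exE conjE)
    fix R u g v h
    assume "sob0 p a b u g" "sob0 q a b v h"
      "0 < integral {a..b} (\<lambda>t. \<bar>u t\<bar> powr \<alpha> * \<bar>v t\<bar> powr \<beta>)"
      and R: "R = ((1/p) * integral {a..b} (\<lambda>t. \<bar>g t\<bar> powr p) + (1/q) * integral {a..b} (\<lambda>t. \<bar>h t\<bar> powr q))
          / integral {a..b} (\<lambda>t. \<bar>u t\<bar> powr \<alpha> * \<bar>v t\<bar> powr \<beta>)"
    then show "0 \<le> R"
      unfolding R using assms(1,2)
      by (intro divide_nonneg_pos add_nonneg_nonneg mult_nonneg_nonneg nonneg[of p u] nonneg[of q v]) auto
  qed
qed (use assms in blast)

text \<open>Because \<open>\<bar>cos_s\<bar> \<le> 1\<close>, raising the exponent lowers the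
  integrand.\<close>

lemma cos_s_powr_integral_le:
  assumes s: "1 < s" and r: "s \<le> r"
  shows "integral {0..pi_s s} (\<lambda>x. \<bar>cos_s s x\<bar> powr r) \<le> integral {0..pi_s s} (\<lambda>x. \<bar>cos_s s x\<bar> powr s)"
  by (intro integral_le integrable_continuous_real continuous_on_abs_cos_s_powr powr_mono' abs_cos_s_le_1)
    (use s r in auto)

text \<open>Hoelder's inequality against the constant 1; the right side equals
  \<open>K powr (r / s) * pi_s s powr (1 - r / s)\<close>. The proof integrates the weighted
  arithmetic-geometric mean inequality.\<close>

lemma cos_s_powr_integral_le_Holder:
  fixes s r :: real
  assumes s: "1 < s" and r: "0 < r" "r < s"
  defines "K \<equiv> integral {0..pi_s s} (\<lambda>x. \<bar>cos_s s x\<bar> powr s)"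
  shows "integral {0..pi_s s} (\<lambda>x. \<bar>cos_s s x\<bar> powr r) \<le> K * (pi_s s / K) powr (1 - r / s)"
proof -
  have K: "0 < K" unfolding K_def cos_s_powr_integral[OF s] using sin_s_powr_integral_pos[OF s] s by simp
  define \<theta> where "\<theta> = r / s"
  have \<theta>: "0 < \<theta>" "\<theta> < 1" using r by (simp_all add: \<theta>_def)
  \<comment> \<open>The mean value of \<open>\<bar>cos_s\<bar> powr s\<close>. With it as second
    entry, the arithmetic mean integrates to
    \<open>\<theta> * K + (1 - \<theta>) * K = K\<close>.\<close>
  define \<mu> where "\<mu> = K / pi_s s"
  have \<mu>: "0 < \<mu>" using K pi_s_pos[OF s] by (simp add: \<mu>_def)
  note int = integrable_integral[OF integrable_continuous_real[OF continuous_on_abs_cos_s_powr[OF s]]]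
  have "((\<lambda>x. \<bar>cos_s s x\<bar> powr r * \<mu> powr (1 - \<theta>)) has_integral
      integral {0..pi_s s} (\<lambda>x. \<bar>cos_s s x\<bar> powr r) * \<mu> powr (1 - \<theta>)) {0..pi_s s}"
    by (intro has_integral_mult_left int r)
  moreover have "((\<lambda>x. \<theta> * \<bar>cos_s s x\<bar> powr s + (1 - \<theta>) * \<mu>) has_integral
      \<theta> * K + pi_s s * ((1 - \<theta>) * \<mu>)) {0..pi_s s}"
  proof (intro has_integral_add has_integral_mult_right)
    show "((\<lambda>x. \<bar>cos_s s x\<bar> powr s) has_integral K) {0..pi_s s}"
      unfolding K_def by (rule int) (use s in simp)
    show "((\<lambda>x. (1 - \<theta>) * \<mu>) has_integral pi_s s * ((1 - \<theta>) * \<mu>)) {0..pi_s s}"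
      using has_integral_const_real[of "(1 - \<theta>) * \<mu>" 0 "pi_s s"] pi_s_pos[OF s] by simp
  qed
  ultimately have "integral {0..pi_s s} (\<lambda>x. \<bar>cos_s s x\<bar> powr r) * \<mu> powr (1 - \<theta>)
      \<le> \<theta> * K + pi_s s * ((1 - \<theta>) * \<mu>)"
  proof (rule has_integral_le)
    fix x
    show "\<bar>cos_s s x\<bar> powr r * \<mu> powr (1 - \<theta>) \<le> \<theta> * \<bar>cos_s s x\<bar> powr s + (1 - \<theta>) * \<mu>"
    proof (cases "cos_s s x = 0")
      case True then show ?thesis using \<theta> \<mu> by simp
    next
      case False
      have "(\<bar>cos_s s x\<bar> powr s) powr \<theta> = \<bar>cos_s s x\<bar> powr r"
        using s by (simp add: \<theta>_def powr_powr)
      then show ?thesis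
        using Youngs_inequality_0[of \<theta> "1 - \<theta>" "\<bar>cos_s s x\<bar> powr s" \<mu>] \<theta> \<mu> False by simp
    qed
  qed
  also have "\<dots> = K" using pi_s_pos[OF s] by (simp add: \<mu>_def field_simps)
  finally have "integral {0..pi_s s} (\<lambda>x. \<bar>cos_s s x\<bar> powr r) \<le> K / \<mu> powr (1 - \<theta>)"
    using \<mu> by (simp add: pos_le_divide_eq)
  also have "\<dots> = K * (pi_s s / K) powr (1 - \<theta>)"
    using K pi_s_pos[OF s] by (simp add: \<mu>_def powr_divide)
  finally show ?thesis by (simp add: \<theta>_def)
qed

theorem theorem1p3:
  fixes p q \<alpha> \<beta> a b :: real
  assumes "1 < q" "q < p" "\<alpha> > 0" "\<beta> > 0" "\<alpha> / p + \<beta> / q = 1" "a < b"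
  shows "lambda1 p q \<alpha> \<beta> a b \<le> Lambda1 (\<alpha> + \<beta>) a b *
     (1/p + (1/q) * (pi_s (\<alpha> + \<beta>) / ((\<alpha> + \<beta> - 1) *
        integral {0..pi_s (\<alpha> + \<beta>)} (\<lambda>t. sin_s (\<alpha> + \<beta>) t powr (\<alpha> + \<beta>))))
        powr (1 - q / (\<alpha> + \<beta>)))"
proof -
  define s where "s = \<alpha> + \<beta>"
  \<comment> \<open>Replacing both denominators in \<open>\<alpha> / p + \<beta> / q = 1\<close> by
    \<open>p\<close> makes the sum smaller than 1, and by \<open>q\<close> larger than 1.\<close>
  have qs: "q < s" and sp: "s < p"
  proof -
    have "\<alpha> / p < \<alpha> / q" "\<beta> / p < \<beta> / q" using assms by (simp_all add: frac_less2)
    then have "s / p < 1" "1 < s / q" using assms(5) by (simp_all add: s_def add_divide_distrib)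
    then show "q < s" "s < p" using assms by (simp_all add: field_simps)
  qed
  have s: "1 < s" using qs assms by simp
  define c where "c = pi_s s / (b - a)"
  have c: "0 < c" "c * (b - a) = pi_s s" using pi_s_pos[OF s] assms by (simp_all add: c_def)
  define S where "S = integral {0..pi_s s} (\<lambda>t. sin_s s t powr s)"
  define K where "K = integral {0..pi_s s} (\<lambda>t. \<bar>cos_s s t\<bar> powr s)"
  have S: "0 < S" and KS: "K = (s - 1) * S"
    using sin_s_powr_integral_pos[OF s] cos_s_powr_integral[OF s] by (simp_all add: S_def K_def)
  \<comment> \<open>Dividing by \<open>c\<close> makes the derivative exactly \<open>cos_s\<close>,
    bounded by 1. The amplitude matters because the two energies scale with different
    powers.\<close>
  define u where "u x = sin_s s (c * (x - a)) / c" for x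
  define g where "g x = cos_s s (c * (x - a))" for x
  have range: "c * (x - a) \<in> {0..pi_s s}" if "x \<in> {a..b}" for x
    using that c mult_left_mono[of "x - a" "b - a" c] by simp
  have rescale: "((\<lambda>x. f (c * (x - a))) has_integral I / c) {a..x}"
    if "(f has_integral I) {0..c * (x - a)}" for f :: "real \<Rightarrow> real" and I x
  proof -
    have image: "(0 - - (c * a)) /\<^sub>R c = a" "(c * (x - a) - - (c * a)) /\<^sub>R c = x"
      using c by (simp_all add: field_simps)
    show ?thesis
      using has_integral_affinity'[of f I 0 "c * (x - a)" c "- (c * a)", unfolded image box_real] that c
      by (simp add: right_diff_distrib divide_inverse_commute)
  qed
  have rescale': "integral {a..b} (\<lambda>x. f (c * (x - a))) = integral {0..pi_s s} f / c"
    if "continuous_on {0..pi_s s} f" for f :: "real \<Rightarrow> real"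
  proof -
    have "(f has_integral integral {0..pi_s s} f) {0..c * (b - a)}"
      unfolding c(2) by (rule integrable_integral[OF integrable_continuous_real[OF that]])
    then show ?thesis by (rule integral_unique[OF rescale])
  qed
  have compose: "continuous_on {a..b} (\<lambda>x. f (c * (x - a)))" if "continuous_on {0..pi_s s} f" for f :: "real \<Rightarrow> real"
    by (rule continuous_on_compose2[OF that]) (use range in \<open>auto intro!: continuous_intros\<close>)
  \<comment> \<open>One function serves for all exponents: \<open>p\<close> and \<open>q\<close> in
    the system, and \<open>s\<close> as a witness for \<open>Lambda1\<close>.\<close>
  have sob: "sob0 r a b u g" if "0 < r" for r
    unfolding sob0_def
  proof (intro conjI ballI)
    have "continuous_on {a..b} g" unfolding g_def by (rule compose[OF continuous_on_cos_s[OF s]])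
    then show "g absolutely_integrable_on {a..b}" by (rule absolutely_integrable_continuous_real)
    show "(\<lambda>t. \<bar>g t\<bar> powr r) integrable_on {a..b}"
      unfolding g_def
      by (rule integrable_continuous_real[OF compose[OF continuous_on_abs_cos_s_powr[OF s that]]])
    show "u x = integral {a..x} g" if "x \<in> {a..b}" for x
      unfolding u_def g_def by (rule integral_unique[OF rescale[OF cos_s_has_integral[OF s range[OF that]]], symmetric])
    show "u b = 0" using sin_s_reflect[OF s, of 0] c sin_s_0[OF s] by (simp add: u_def)
  qed
  have gint: "integral {a..b} (\<lambda>t. \<bar>g t\<bar> powr r) = integral {0..pi_s s} (\<lambda>t. \<bar>cos_s s t\<bar> powr r) / c"
    if "0 < r" for r
    unfolding g_def by (rule rescale'[OF continuous_on_abs_cos_s_powr[OF s that]])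
  have "integral {a..b} (\<lambda>t. \<bar>u t\<bar> powr \<alpha> * \<bar>u t\<bar> powr \<beta>)
      = integral {a..b} (\<lambda>t. sin_s s (c * (t - a)) powr s * (1 / c powr s))"
  proof (rule integral_cong)
    fix t assume "t \<in> {a..b}"
    then have "0 \<le> sin_s s (c * (t - a))" using sin_s_bounds[OF s range] by auto
    then show "\<bar>u t\<bar> powr \<alpha> * \<bar>u t\<bar> powr \<beta> = sin_s s (c * (t - a)) powr s * (1 / c powr s)"
      using c by (simp add: u_def powr_add[symmetric] powr_divide flip: s_def)
  qed
  also have "\<dots> = S / c * (1 / c powr s)"
    using rescale'[OF continuous_on_sin_s_powr[OF s, of s]] s by (simp add: S_def)
  finally have uint: "integral {a..b} (\<lambda>t. \<bar>u t\<bar> powr \<alpha> * \<bar>u t\<bar> powr \<beta>) = S / c * (1 / c powr s)" .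
  then have upos: "0 < integral {a..b} (\<lambda>t. \<bar>u t\<bar> powr \<alpha> * \<bar>u t\<bar> powr \<beta>)" using S c by simp
  let ?B = "1/p + (1/q) * (pi_s s / K) powr (1 - q / s)"
  have "lambda1 p q \<alpha> \<beta> a b \<le> ((1/p) * integral {a..b} (\<lambda>t. \<bar>g t\<bar> powr p)
      + (1/q) * integral {a..b} (\<lambda>t. \<bar>g t\<bar> powr q)) / integral {a..b} (\<lambda>t. \<bar>u t\<bar> powr \<alpha> * \<bar>u t\<bar> powr \<beta>)"
    by (rule lambda1_le[OF _ _ sob sob upos]) (use assms in auto)
  also have "\<dots> \<le> ((1/p) * (K / c) + (1/q) * (K * (pi_s s / K) powr (1 - q / s) / c))
      / integral {a..b} (\<lambda>t. \<bar>u t\<bar> powr \<alpha> * \<bar>u t\<bar> powr \<beta>)"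
  proof (intro divide_right_mono add_mono mult_left_mono)
    show "integral {a..b} (\<lambda>t. \<bar>g t\<bar> powr p) \<le> K / c"
      using cos_s_powr_integral_le[OF s, of p] gint[of p] sp s c by (simp add: K_def divide_right_mono)
    show "integral {a..b} (\<lambda>t. \<bar>g t\<bar> powr q) \<le> K * (pi_s s / K) powr (1 - q / s) / c"
      using cos_s_powr_integral_le_Holder[OF s, of q] gint[of q] qs assms c
      by (simp add: K_def divide_right_mono)
  qed (use assms upos in auto)
  \<comment> \<open>Every energy carries the Jacobian \<open>1 / c\<close>, as does the denominator,
    so only the amplitude factor \<open>c powr s\<close> survives.\<close>
  also have "\<dots> = K * ?B / S * c powr s"
    unfolding uint using S c by (simp add: field_simps)
  also have "\<dots> = (s - 1) * c powr s * ?B" unfolding KS using S by simp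
  also have "\<dots> \<le> Lambda1 s a b * ?B"
  proof (rule mult_right_mono)
    \<comment> \<open>If \<open>u\<close> vanished identically, so would the coupling integral,
      which is positive.\<close>
    have "\<exists>x\<in>{a..b}. u x \<noteq> 0"
    proof (rule ccontr)
      assume "\<not> (\<exists>x\<in>{a..b}. u x \<noteq> 0)"
      then have "integral {a..b} (\<lambda>t. \<bar>u t\<bar> powr \<alpha> * \<bar>u t\<bar> powr \<beta>) = integral {a..b} (\<lambda>t. 0)"
        by (intro integral_cong) simp
      then show False using upos by simp
    qed
    then show "(s - 1) * c powr s \<le> Lambda1 s a b"
      unfolding c_def using Lambda1_ge[OF s assms(6) sob] s by simp
  qed (use assms in simp)
  finally show ?thesis by (simp add: KS S_def s_def)
qed

end
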